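(* Let $X\neq\{0\}$ be a real Hilbert space and let $e\in X$ satisfy $\|e\|<1$. Then the following hold: (i) $A_e$ is strongly monotone, with sharp constant $\frac{1-\|e\|}{1+\|e\|}$. (ii) $A_e$ is cocoercive, with sharp constant $\frac{1-\|e\|}{1+\|e\|}$. (iii) $A_e$ is paramonotone. (iv) $A_e$ is $3^*$ monotone. (v) $A_e$ is a displacement map if and only if $\|e\|\le\frac13$.
   Context: For $e$ in a real Hilbert space $X\ne\{0\}$ with $\|e\|\le 1$, define $R_e\colon X\to X\colon x\mapsto \|x\|\,e$ and $T_e\colon X\to X\colon x\mapsto \tfrac12 x+\tfrac12 R_e x=\tfrac12x+\tfrac12\|x\|e$. The map $R_e$ is nonexpansive, so $T_e$ is firmly nonexpansive and is the resolvent $J_{A_e}=(\mathrm{Id}+A_e)^{-1}$ of the maximally monotone set-valued operator $A_e=T_e^{-1}-\mathrm{Id}$ (inverse in the sense of set-valued operators); equivalently, the graph of $A_e$ is $\operatorname{gra}A_e=\{(T_ey,\,y-T_ey) : y\in X\}$. When $\|e\|<1$, $A_e$ is single-valued with domain $X$, explicitly $A_ex=x+\frac{2\langle e,x\rangle-2\sqrt{(1-\|e\|^2)\|x\|^2+\langle e,x\rangle^2}}{1-\|e\|^2}\,e$ for every $x\in X$. Let $A\colon X\to X$ be single-valued and monotone. $A$ is strongly monotone with constant $\beta>0$ if $\langle x-y,Ax-Ay\rangle\ge\beta\|x-y\|^2$ for all $x,y\in X$. $A$ is cocoercive with constant $\beta>0$ if $\langle x-y,Ax-Ay\rangle\ge\beta\|Ax-Ay\|^2$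 for all $x,y\in X$. In either case the constant is sharp if it is the largest constant for which the inequality holds for all $x,y\in X$. $A$ is paramonotone if for all $x,y\in X$ with $\langle x-y,Ax-Ay\rangle=0$ one has $Ax=Ay$. $A$ is $3^*$ monotone if for all $x\in X$ and all $u\in\operatorname{ran}A$, $\inf_{z\in X}\langle x-z,u-Az\rangle>-\infty$. $A$ is a displacement map if $A=\mathrm{Id}-N$ for some nonexpansive (i.e. $1$-Lipschitz) $N\colon X\to X$. *)

theory Defs
  imports "HOL-Analysis.Analysis"
begin

definition R_map :: "'a::real_inner \<Rightarrow> 'a \<Rightarrow> 'a" where
  "R_map e x = norm x *\<^sub>R e"

definition T_map :: "'a::real_inner \<Rightarrow> 'a \<Rightarrow> 'a" where
  "T_map e x = (1/2) *\<^sub>R x + (1/2) *\<^sub>R R_map e x"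

text \<open>The set-valued operator \<open>T\<^sub>e\<inverse> - Id\<close>; set-valued operators are functions into sets,
  so the inverse of \<open>T\<^sub>e\<close> sends \<open>x\<close> to its preimage.\<close>

definition A_set :: "'a::real_inner \<Rightarrow> 'a \<Rightarrow> 'a set" where
  "A_set e x = (\<lambda>y. y - x) ` (T_map e -` {x})"

text \<open>The single-valued version, meaningful when \<open>norm e < 1\<close>; see \<open>A_set_eq_singleton\<close> below.\<close>

definition A_op :: "'a::real_inner \<Rightarrow> 'a \<Rightarrow> 'a" where
  "A_op e x = (THE u. u \<in> A_set e x)"

lemma A_set_eq_singleton:
  fixes e x :: "'a::{real_inner, complete_space}"
  assumes "norm e < 1"
  shows "A_set e x = {A_op e x}"
proof -
  define f where "f = (\<lambda>y::'a. 2 *\<^sub>R x - norm y *\<^sub>R e)"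
  have fix_iff: "T_map e y = x \<longleftrightarrow> f y = y" for y
  proof -
    have "2 *\<^sub>R T_map e y = y + norm y *\<^sub>R e"
      by (simp add: T_map_def R_map_def scaleR_add_right)
    moreover have "T_map e y = x \<longleftrightarrow> 2 *\<^sub>R T_map e y = 2 *\<^sub>R x"
      by simp
    ultimately have "T_map e y = x \<longleftrightarrow> y + norm y *\<^sub>R e = 2 *\<^sub>R x"
      by metis
    also have "\<dots> \<longleftrightarrow> y = 2 *\<^sub>R x - norm y *\<^sub>R e"
      by (rule eq_diff_eq[symmetric])
    also have "\<dots> \<longleftrightarrow> f y = y"
      unfolding f_def by (rule eq_commute)
    finally show ?thesis .
  qed
  have contr: "dist (f y) (f z) \<le> norm e * dist y z" for y z
  proof -
    have "f y - f z = (norm z - norm y) *\<^sub>R e"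
      by (simp add: f_def scaleR_left_diff_distrib)
    then have "dist (f y) (f z) = \<bar>norm z - norm y\<bar> * norm e"
      by (simp add: dist_norm)
    also have "\<dots> \<le> dist y z * norm e"
      using norm_triangle_ineq3[of z y]
      by (intro mult_right_mono) (simp_all add: dist_norm norm_minus_commute[of y z])
    finally show ?thesis by (simp add: mult.commute)
  qed
  have "\<exists>!y. f y = y"
    using banach_fix_type[of "norm e" f] assms contr by simp
  then obtain y where y: "\<And>z. f z = z \<longleftrightarrow> z = y"
    by metis
  then have "T_map e -` {x} = {y}"
    by (simp add: vimage_def fix_iff y)
  then show ?thesis
    by (simp add: A_op_def A_set_def)
qed

definition monotone_op :: "('a::real_inner \<Rightarrow> 'a) \<Rightarrow> bool" where
  "monotone_op A \<longleftrightarrow> (\<forall>x y. inner (x - y) (A x - A y) \<ge> 0)"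

definition strongly_monotone :: "real \<Rightarrow> ('a::real_inner \<Rightarrow> 'a) \<Rightarrow> bool" where
  "strongly_monotone \<beta> A \<longleftrightarrow>
     \<beta> > 0 \<and> (\<forall>x y. inner (x - y) (A x - A y) \<ge> \<beta> * (norm (x - y))\<^sup>2)"

definition cocoercive :: "real \<Rightarrow> ('a::real_inner \<Rightarrow> 'a) \<Rightarrow> bool" where
  "cocoercive \<beta> A \<longleftrightarrow>
     \<beta> > 0 \<and> (\<forall>x y. inner (x - y) (A x - A y) \<ge> \<beta> * (norm (A x - A y))\<^sup>2)"

definition sharp_constant :: "(real \<Rightarrow> bool) \<Rightarrow> real \<Rightarrow> bool" where
  "sharp_constant P \<beta> \<longleftrightarrow> P \<beta> \<and> (\<forall>\<gamma>. P \<gamma> \<longrightarrow> \<gamma> \<le> \<beta>)"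

text \<open>Paramonotonicity and \<open>3\<^sup>*\<close> monotonicity are properties of monotone operators, so both
  definitions include monotonicity, which their second conjunct does not imply.\<close>

definition paramonotone :: "('a::real_inner \<Rightarrow> 'a) \<Rightarrow> bool" where
  "paramonotone A \<longleftrightarrow>
     monotone_op A \<and> (\<forall>x y. inner (x - y) (A x - A y) = 0 \<longrightarrow> A x = A y)"

definition three_star_monotone :: "('a::real_inner \<Rightarrow> 'a) \<Rightarrow> bool" where
  "three_star_monotone A \<longleftrightarrow>
     monotone_op A \<and>
     (\<forall>x. \<forall>u \<in> range A. (INF z. ereal (inner (x - z) (u - A z))) > -\<infinity>)"

definition displacement_map :: "('a::real_inner \<Rightarrow> 'a) \<Rightarrow> bool" where
  "displacement_map A \<longleftrightarrow> (\<exists>N. 1-lipschitz_on UNIV N \<and> A = (\<lambda>x. x - N x))"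

end

theory Submission
  imports Defs
begin

text \<open>
  The graph of \<open>A\<^sub>e\<close> is best described by the Minty parametrization
  \<open>y \<mapsto> (T\<^sub>e y, y - T\<^sub>e y)\<close>: here \<open>y - T\<^sub>e y = T\<^sub>-\<^sub>e y\<close>, so that \<open>A\<^sub>e\<close> sends \<open>T\<^sub>e y\<close> to
  \<open>T\<^sub>-\<^sub>e y\<close>.  Put \<open>d = y - z\<close> and
  \<open>\<delta> = \<parallel>y\<parallel> - \<parallel>z\<parallel>\<close>, so that \<open>\<bar>\<delta>\<bar> \<le> \<parallel>d\<parallel>\<close>.  Two points of the graph differ by
  \<open>((d + \<delta> e)/2, (d - \<delta> e)/2)\<close>, and the inner product of the two components is
  \<open>(\<parallel>d\<parallel>\<^sup>2 - \<delta>\<^sup>2 \<parallel>e\<parallel>\<^sup>2)/4\<close>.  This product factors into \<open>\<parallel>d\<parallel> - \<bar>\<delta>\<bar> \<parallel>e\<parallel>\<close> and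
  \<open>\<parallel>d\<parallel> + \<bar>\<delta>\<bar> \<parallel>e\<parallel>\<close>; the second factor dominates \<open>\<parallel>d + \<delta> e\<parallel>\<close>, and since \<open>\<bar>\<delta>\<bar> \<le> \<parallel>d\<parallel>\<close>, the
  first is at least \<open>(1 - \<parallel>e\<parallel>)/(1 + \<parallel>e\<parallel>)\<close> times the second.  This is strong monotonicity
  (\<open>Minty_pair_strongly_monotone\<close>).

  The parametrization also shows that \<open>A\<^sub>-\<^sub>e\<close> is the inverse of \<open>A\<^sub>e\<close>, so cocoercivity of
  \<open>A\<^sub>e\<close> is strong monotonicity of \<open>A\<^sub>-\<^sub>e\<close>, with the same constant
  (\<open>cocoercive_A_op_iff\<close>).  Paramonotonicity and \<open>3\<^sup>*\<close> monotonicity hold for every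
  cocoercive operator.  Finally \<open>Id - A\<^sub>e\<close> sends \<open>T\<^sub>e y\<close> to \<open>\<parallel>y\<parallel> e\<close>, so \<open>A\<^sub>e\<close> is a displacement
  map exactly when \<open>2 \<bar>\<delta>\<bar> \<parallel>e\<parallel> \<le> \<parallel>d + \<delta> e\<parallel>\<close> always holds.  As \<open>\<parallel>d + \<delta> e\<parallel> \<ge> \<bar>\<delta>\<bar> (1 - \<parallel>e\<parallel>)\<close>,
  this follows from \<open>3 \<parallel>e\<parallel> \<le> 1\<close>.

  All the extremal cases lie on the line through \<open>e\<close>: for a unit vector \<open>v\<close> with
  \<open>e = \<parallel>e\<parallel> v\<close>, the choice \<open>z = 0\<close> with \<open>y = v\<close> attains equality in strong monotonicity, and with
  \<open>y = - v\<close> it forces \<open>2 \<parallel>e\<parallel> \<le> 1 - \<parallel>e\<parallel>\<close> for a displacement map.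
\<close>

section \<open>Cocoercive operators and displacement maps\<close>

lemma cocoercive_imp_monotone_op:
  assumes "cocoercive \<beta> A"
  shows "monotone_op A"
  unfolding monotone_op_def
proof (intro allI)
  fix x y
  have "0 \<le> \<beta> * (norm (A x - A y))\<^sup>2"
    using assms by (simp add: cocoercive_def)
  also have "\<dots> \<le> inner (x - y) (A x - A y)"
    using assms by (simp add: cocoercive_def)
  finally show "0 \<le> inner (x - y) (A x - A y)" .
qed

lemma cocoercive_imp_paramonotone:
  assumes "cocoercive \<beta> A"
  shows "paramonotone A"
proof -
  have "A x = A y" if "inner (x - y) (A x - A y) = 0" for x y
  proof -
    have "\<beta> * (norm (A x - A y))\<^sup>2 \<le> 0" and "\<beta> > 0"
      using assms that by (metis cocoercive_def)+
    then show ?thesis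
      by (simp add: mult_le_0_iff)
  qed
  then show ?thesis
    using cocoercive_imp_monotone_op[OF assms] by (simp add: paramonotone_def)
qed

text \<open>With \<open>u = A w\<close>, the expression to be bounded below is at least
  \<open>\<beta> t\<^sup>2 - \<parallel>x - w\<parallel> t\<close> for \<open>t = \<parallel>A w - A z\<parallel>\<close>, and a quadratic polynomial with positive
  leading coefficient is bounded below.\<close>

lemma cocoercive_imp_three_star_monotone:
  assumes "cocoercive \<beta> A"
  shows "three_star_monotone A"
proof -
  have \<beta>: "\<beta> > 0"
    using assms by (simp add: cocoercive_def)
  have "(INF z. ereal (inner (x - z) (A w - A z))) > -\<infinity>" for x w
  proof -
    have "- ((norm (x - w))\<^sup>2 / (4 * \<beta>)) \<le> inner (x - z) (A w - A z)" for z
    proof -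
      let ?t = "norm (A w - A z)" and ?c = "norm (x - w)"
      have "- (?c\<^sup>2 / (4 * \<beta>)) \<le> \<beta> * ?t\<^sup>2 - ?c * ?t"
      proof -
        have "\<beta> * ?t\<^sup>2 - ?c * ?t + ?c\<^sup>2 / (4 * \<beta>) = (2 * \<beta> * ?t - ?c)\<^sup>2 / (4 * \<beta>)"
          using \<beta> by (simp add: field_simps power2_eq_square)
        moreover have "\<dots> \<ge> 0"
          using \<beta> by simp
        ultimately show ?thesis by linarith
      qed
      also have "\<dots> \<le> inner (w - z) (A w - A z) + inner (x - w) (A w - A z)"
      proof -
        have "\<beta> * ?t\<^sup>2 \<le> inner (w - z) (A w - A z)"
          using assms by (simp add: cocoercive_def)
        moreover have "- (?c * ?t) \<le> inner (x - w) (A w - A z)"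
          using Cauchy_Schwarz_ineq2[of "x - w" "A w - A z"] by linarith
        ultimately show ?thesis by linarith
      qed
      also have "\<dots> = inner (x - z) (A w - A z)"
        by (simp add: inner_diff_left)
      finally show ?thesis .
    qed
    then have "ereal (- ((norm (x - w))\<^sup>2 / (4 * \<beta>))) \<le> (INF z. ereal (inner (x - z) (A w - A z)))"
      by (intro INF_greatest) simp
    then show ?thesis
      by (rule less_le_trans[rotated]) simp
  qed
  then show ?thesis
    using cocoercive_imp_monotone_op[OF assms] by (auto simp: three_star_monotone_def)
qed

lemma displacement_map_iff:
  "displacement_map A \<longleftrightarrow> (\<forall>x y. norm ((x - A x) - (y - A y)) \<le> norm (x - y))"
proof
  assume "displacement_map A"
  then show "\<forall>x y. norm ((x - A x) - (y - A y)) \<le> norm (x - y)"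
    by (auto simp: displacement_map_def lipschitz_on_def dist_norm)
next
  assume "\<forall>x y. norm ((x - A x) - (y - A y)) \<le> norm (x - y)"
  then have "1-lipschitz_on UNIV (\<lambda>x. x - A x)"
    by (simp add: lipschitz_on_def dist_norm)
  then show "displacement_map A"
    by (auto simp: displacement_map_def intro!: exI[of _ "\<lambda>x. x - A x"])
qed

section \<open>The Minty parametrization of the graph\<close>

lemma surj_T_map:
  fixes e :: "'a::{real_inner, complete_space}"
  assumes "norm e < 1"
  shows "surj (T_map e)"
proof -
  have "\<exists>y. x = T_map e y" for x
    using A_set_eq_singleton[OF assms, of x] by (auto simp: A_set_def)
  then show ?thesis by (auto simp: surj_def)
qed

lemma all2_iff_all2_T_map:
  fixes e :: "'a::{real_inner, complete_space}"
  assumes "norm e < 1"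
  shows "(\<forall>x x'. P x x') \<longleftrightarrow> (\<forall>y z. P (T_map e y) (T_map e z))"
  using surj_T_map[OF assms] by (metis surjD)

lemma A_op_T_map:
  fixes e :: "'a::{real_inner, complete_space}"
  assumes "norm e < 1"
  shows "A_op e (T_map e y) = T_map (- e) y"
proof -
  have "y - T_map e y \<in> A_set e (T_map e y)"
    by (auto simp: A_set_def)
  then have "A_op e (T_map e y) = y - T_map e y"
    using A_set_eq_singleton[OF assms] by simp
  also have "y - T_map e y = T_map (- e) y"
  proof -
    have "y = (1/2) *\<^sub>R y + (1/2) *\<^sub>R y"
      by (simp flip: scaleR_left_distrib)
    then show ?thesis
      by (simp add: T_map_def R_map_def algebra_simps)
  qed
  finally show ?thesis .
qed

lemma T_map_diff:
  "T_map e y - T_map e z = (1/2) *\<^sub>R ((y - z) + (norm y - norm z) *\<^sub>R e)"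
  by (simp add: T_map_def R_map_def algebra_simps)

lemma inner_T_map_diff:
  "inner (T_map e y - T_map e z) (T_map (- e) y - T_map (- e) z)
     = ((norm (y - z))\<^sup>2 - ((norm y - norm z) * norm e)\<^sup>2) / 4"
proof -
  define d s where "d = y - z" and "s = norm y - norm z"
  have "inner (d + s *\<^sub>R e) (d - s *\<^sub>R e) = (norm d)\<^sup>2 - (s * norm e)\<^sup>2"
    by (simp add: inner_simps power2_norm_eq_inner power_mult_distrib inner_commute)
       (simp add: power2_eq_square)
  then show ?thesis
    by (simp add: T_map_diff d_def s_def)
qed

lemma strongly_monotone_A_op_iff:
  fixes e :: "'a::{real_inner, complete_space}"
  assumes "norm e < 1"
  shows "strongly_monotone \<beta> (A_op e) \<longleftrightarrow>
    \<beta> > 0 \<and> (\<forall>y z. \<beta> * (norm (T_map e y - T_map e z))\<^sup>2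
               \<le> inner (T_map e y - T_map e z) (T_map (- e) y - T_map (- e) z))"
  unfolding strongly_monotone_def
  by (subst all2_iff_all2_T_map[OF assms]) (simp add: A_op_T_map[OF assms])

text \<open>Swapping the two components of the graph of \<open>A\<^sub>e\<close> replaces \<open>e\<close> by \<open>- e\<close>, that is, the
  two operators are inverse to each other; inversion exchanges strong monotonicity and
  cocoercivity.\<close>

lemma cocoercive_A_op_iff:
  fixes e :: "'a::{real_inner, complete_space}"
  assumes "norm e < 1"
  shows "cocoercive \<beta> (A_op e) \<longleftrightarrow> strongly_monotone \<beta> (A_op (- e))"
proof -
  have "norm (- e) < 1"
    using assms by simp
  then show ?thesis
    unfolding cocoercive_def strongly_monotone_A_op_iff[OF \<open>norm (- e) < 1\<close>]
    by (subst all2_iff_all2_T_map[OF assms]) (simp add: A_op_T_map[OF assms] inner_commute)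
qed

section \<open>The sharp constant and the displacement criterion\<close>

lemma Minty_pair_strongly_monotone:
  assumes "norm e < 1"
  shows "(1 - norm e) / (1 + norm e) * (norm (T_map e y - T_map e z))\<^sup>2
    \<le> inner (T_map e y - T_map e z) (T_map (- e) y - T_map (- e) z)"
proof -
  define d s r where "d = norm (y - z)" and "s = norm y - norm z" and "r = \<bar>s\<bar> * norm e"
  have "\<bar>s\<bar> \<le> d"
    unfolding s_def d_def by (rule norm_triangle_ineq3)
  then have r: "0 \<le> r" "r \<le> d * norm e"
    by (simp_all add: r_def mult_right_mono)
  have ratio: "(1 - norm e) / (1 + norm e) * (d + r) \<le> d - r"
  proof -
    have "(1 - norm e) * (d + r) \<le> (d - r) * (1 + norm e)"
      using r by (simp add: algebra_simps)
    moreover have "1 + norm e > 0"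
      using norm_ge_zero[of e] by linarith
    ultimately show ?thesis
      by (simp add: pos_divide_le_eq)
  qed
  have "norm ((y - z) + s *\<^sub>R e) \<le> d + r"
    using norm_triangle_ineq[of "y - z" "s *\<^sub>R e"] by (simp add: d_def r_def)
  then have "(1 - norm e) / (1 + norm e) * (norm ((y - z) + s *\<^sub>R e))\<^sup>2
      \<le> (1 - norm e) / (1 + norm e) * (d + r)\<^sup>2"
    using assms by (intro mult_left_mono power_mono) simp_all
  also have "\<dots> = (1 - norm e) / (1 + norm e) * (d + r) * (d + r)"
    by (simp add: power2_eq_square)
  also have "\<dots> \<le> (d - r) * (d + r)"
    using r by (intro mult_right_mono ratio) (simp_all add: d_def)
  also have "\<dots> = d\<^sup>2 - (s * norm e)\<^sup>2"
    by (simp add: r_def power2_eq_square algebra_simps)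
  finally have "(1 - norm e) / (1 + norm e) * (norm ((y - z) + s *\<^sub>R e))\<^sup>2 / 4
      \<le> (d\<^sup>2 - (s * norm e)\<^sup>2) / 4"
    by (rule divide_right_mono) simp
  moreover have "norm (T_map e y - T_map e z) = norm ((y - z) + s *\<^sub>R e) / 2"
    by (simp add: T_map_diff s_def)
  ultimately show ?thesis
    by (simp only: inner_T_map_diff d_def s_def power_divide times_divide_eq_right) simp
qed

text \<open>A unit vector along \<open>e\<close>; for \<open>e = 0\<close> any unit vector serves, which is where the space
  has to be nontrivial.\<close>

lemma unit_vector_along:
  fixes e :: "'a::real_inner"
  assumes "(UNIV :: 'a set) \<noteq> {0}"
  obtains v :: 'a where "norm v = 1" and "e = norm e *\<^sub>R v"
proof (cases "e = 0")
  case True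
  obtain w :: 'a where "w \<noteq> 0"
    using assms by auto
  then show ?thesis
    using that[of "sgn w"] True by (simp add: norm_sgn)
next
  case False
  then show ?thesis
    using that[of "sgn e"] by (simp add: norm_sgn sgn_div_norm)
qed

lemma T_map_unit_vector:
  assumes "norm v = 1" and "e = norm e *\<^sub>R v"
  shows "T_map e v = ((1 + norm e) / 2) *\<^sub>R v"
    and "T_map (- e) v = ((1 - norm e) / 2) *\<^sub>R v"
    and "T_map e (- v) = - ((1 - norm e) / 2) *\<^sub>R v"
proof -
  define c where "c = norm e"
  then have e: "e = c *\<^sub>R v"
    using assms by simp
  show "T_map e v = ((1 + norm e) / 2) *\<^sub>R v"
    and "T_map (- e) v = ((1 - norm e) / 2) *\<^sub>R v"
    and "T_map e (- v) = - ((1 - norm e) / 2) *\<^sub>R v"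
    unfolding c_def[symmetric] unfolding e
    by (simp_all add: T_map_def R_map_def assms(1) add_divide_distrib diff_divide_distrib
        scaleR_left_distrib scaleR_left_diff_distrib)
qed

lemma T_map_zero [simp]: "T_map e 0 = 0"
  by (simp add: T_map_def R_map_def)

text \<open>Equality in strong monotonicity is attained at the pair of points with parameters \<open>v\<close>
  and \<open>0\<close>.\<close>

lemma A_op_strongly_monotone_sharp:
  fixes e :: "'a::{real_inner, complete_space}"
  assumes "(UNIV :: 'a set) \<noteq> {0}" and "norm e < 1"
  shows "sharp_constant (\<lambda>\<beta>. strongly_monotone \<beta> (A_op e)) ((1 - norm e) / (1 + norm e))"
proof -
  have pos: "1 + norm e > 0"
    using norm_ge_zero[of e] by linarith
  have "strongly_monotone ((1 - norm e) / (1 + norm e)) (A_op e)"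
    using assms(2) pos Minty_pair_strongly_monotone[OF assms(2)]
    by (simp add: strongly_monotone_A_op_iff)
  moreover have "\<gamma> \<le> (1 - norm e) / (1 + norm e)" if "strongly_monotone \<gamma> (A_op e)" for \<gamma>
  proof -
    obtain v where v: "norm v = 1" "e = norm e *\<^sub>R v"
      using unit_vector_along[OF assms(1)] .
    have "\<gamma> * (norm (T_map e v - T_map e 0))\<^sup>2
        \<le> inner (T_map e v - T_map e 0) (T_map (- e) v - T_map (- e) 0)"
      using that strongly_monotone_A_op_iff[OF assms(2)] by blast
    then have "\<gamma> * ((1 + norm e) / 2)\<^sup>2 \<le> (1 + norm e) / 2 * ((1 - norm e) / 2)"
      using v(1) pos by (simp add: T_map_unit_vector[OF v] dot_square_norm mult.commute)
    then have "(1 + norm e) / 2 * (\<gamma> * ((1 + norm e) / 2)) \<le> (1 + norm e) / 2 * ((1 - norm e) / 2)"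
      by (simp only: power2_eq_square mult_ac)
    then have "\<gamma> * ((1 + norm e) / 2) \<le> (1 - norm e) / 2"
      using pos by (simp only: mult_le_cancel_left_pos half_gt_zero)
    then show ?thesis
      using pos by (simp add: pos_le_divide_eq)
  qed
  ultimately show ?thesis
    by (simp add: sharp_constant_def)
qed

lemma A_op_displacement_map_iff:
  fixes e :: "'a::{real_inner, complete_space}"
  assumes "(UNIV :: 'a set) \<noteq> {0}" and "norm e < 1"
  shows "displacement_map (A_op e) \<longleftrightarrow> norm e \<le> 1 / 3"
proof -
  have Id_minus_A: "T_map e y - A_op e (T_map e y) = norm y *\<^sub>R e" for y
    unfolding A_op_T_map[OF assms(2)]
    by (simp add: T_map_def R_map_def flip: scaleR_left_distrib)
  have "displacement_map (A_op e) \<longleftrightarrow>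
      (\<forall>y z. norm (norm y *\<^sub>R e - norm z *\<^sub>R e) \<le> norm (T_map e y - T_map e z))"
    unfolding displacement_map_iff
    by (subst all2_iff_all2_T_map[OF assms(2)]) (simp add: Id_minus_A)
  also have "\<dots> \<longleftrightarrow> norm e \<le> 1 / 3"
  proof
    assume lip: "\<forall>y z. norm (norm y *\<^sub>R e - norm z *\<^sub>R e) \<le> norm (T_map e y - T_map e z)"
    obtain v where v: "norm v = 1" "e = norm e *\<^sub>R v"
      using unit_vector_along[OF assms(1)] .
    have "norm e \<le> norm (T_map e (- v))"
      using lip[rule_format, of "- v" 0] v(1) by simp
    also have "\<dots> = (1 - norm e) / 2"
      using v(1) assms(2) by (simp add: T_map_unit_vector[OF v])
    finally show "norm e \<le> 1 / 3"
      by simp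
  next
    assume e: "norm e \<le> 1 / 3"
    show "\<forall>y z. norm (norm y *\<^sub>R e - norm z *\<^sub>R e) \<le> norm (T_map e y - T_map e z)"
    proof (intro allI)
      fix y z :: 'a
      define s where "s = norm y - norm z"
      have "\<bar>s\<bar> * (3 * norm e) \<le> \<bar>s\<bar> * 1"
        using e by (intro mult_left_mono) simp_all
      also have "\<dots> \<le> norm (y - z)"
        using norm_triangle_ineq3[of y z] by (simp add: s_def)
      finally have "2 * (\<bar>s\<bar> * norm e) \<le> norm (y - z) - norm (s *\<^sub>R e)"
        by simp
      also have "\<dots> \<le> norm ((y - z) + s *\<^sub>R e)"
        by (rule norm_diff_ineq)
      finally show "norm (norm y *\<^sub>R e - norm z *\<^sub>R e) \<le> norm (T_map e y - T_map e z)"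
        by (simp add: T_map_diff s_def flip: scaleR_left_diff_distrib)
    qed
  qed
  finally show ?thesis .
qed

theorem proposition3p3:
  fixes e :: "'a::{real_inner, complete_space}"
  assumes "(UNIV :: 'a set) \<noteq> {0}"
    and "norm e < 1"
  shows "sharp_constant (\<lambda>\<beta>. strongly_monotone \<beta> (A_op e)) ((1 - norm e) / (1 + norm e))
    \<and> sharp_constant (\<lambda>\<beta>. cocoercive \<beta> (A_op e)) ((1 - norm e) / (1 + norm e))
    \<and> paramonotone (A_op e)
    \<and> three_star_monotone (A_op e)
    \<and> (displacement_map (A_op e) \<longleftrightarrow> norm e \<le> 1 / 3)"
proof -
  have coco: "sharp_constant (\<lambda>\<beta>. cocoercive \<beta> (A_op e)) ((1 - norm e) / (1 + norm e))"
    using A_op_strongly_monotone_sharp[of "- e"] assms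
    by (simp add: cocoercive_A_op_iff)
  then have "cocoercive ((1 - norm e) / (1 + norm e)) (A_op e)"
    by (simp add: sharp_constant_def)
  then show ?thesis
    using coco A_op_strongly_monotone_sharp[OF assms] A_op_displacement_map_iff[OF assms]
      cocoercive_imp_paramonotone cocoercive_imp_three_star_monotone by blast
qed

end
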